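(* Let $n \geq 1$ and let $x_1,\dots,x_n$, $y_1,\dots,y_n$ and $t$ be indeterminates. Then $$ \sum_{\lambda} \prod_{i=1}^{n} \left(1-t^{\lambda_i-i+n+1}\right) s_{\lambda}(x_1,\dots,x_n)\, s_{\lambda}(y_1,\dots,y_n) = \frac{1}{\prod_{1\leq i<j\leq n}(x_i-x_j)\ \prod_{1\leq i<j\leq n}(y_i-y_j)} \det\left[\frac{(1-t)}{(1-x_i y_j)(1-t x_i y_j)}\right]_{1\leq i,j\leq n}, $$ where the sum is over all partitions $\lambda=(\lambda_1\geq\cdots\geq\lambda_n\geq 0)$ with at most $n$ non-zero parts.
   Context: A partition is a finite weakly decreasing sequence of positive integers (possibly empty); a partition with at most $n$ parts is padded with zeros so that $\lambda_1,\dots,\lambda_n$ are all defined. The Schur polynomial of a partition $\lambda$ with at most $n$ parts is $$ s_{\lambda}(x_1,\dots,x_n)=\frac{\det\left[x_i^{\lambda_j-j+n}\right]_{1\leq i,j\leq n}}{\prod_{1\leq i<j\leq n}(x_i-x_j)} . $$ The identity is understood as one of formal power series in $x_1,\dots,x_n,y_1,\dots,y_n$ with coefficients polynomial in $t$, the entries of the determinant being expanded as geometric series in the variables $x_i y_j$. *)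

theory Defs
  imports
    "HOL-Library.Multiset_Order"
    "HOL-Computational_Algebra.Polynomial_Factorial"
    "Jordan_Normal_Form.Determinant"
begin

section \<open>Formal power series in arbitrarily many variables\<close>

text \<open>
  A monomial in variables of type \<open>'v\<close> is a finite multiset of variables, for example
  \<open>{#u, u, v#}\<close> is \<open>u\<^sup>2 v\<close>; multiplication of monomials is addition of multisets and the
  total degree is the size.  A power series is an arbitrary family of coefficients.
\<close>

typedef ('v, 'a) mfps = "UNIV :: ('v multiset \<Rightarrow> 'a) set"
  morphisms mfps_coeff Abs_mfps ..

lemma mfps_eqI: "(\<And>m. mfps_coeff f m = mfps_coeff g m) \<Longrightarrow> f = g"
  using mfps_coeff_inject[of f g] by auto

lemma mfps_coeff_Abs [simp]: "mfps_coeff (Abs_mfps c) = c"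
  by (simp add: Abs_mfps_inverse)

definition splits :: "'v multiset \<Rightarrow> ('v multiset \<times> 'v multiset) set" where
  "splits m = {(a, b). a + b = m}"

lemma finite_splits [simp, intro]: "finite (splits m)"
proof (rule finite_subset)
  let ?B = "{a. set_mset a \<subseteq> set_mset m \<and> size a \<le> size m}"
  show "splits m \<subseteq> ?B \<times> ?B"
    by (auto simp: splits_def)
  have "?B \<subseteq> mset ` {xs. set xs \<subseteq> set_mset m \<and> length xs \<le> size m}"
  proof
    fix a assume "a \<in> ?B"
    moreover obtain xs where "mset xs = a"
      using ex_mset by blast
    ultimately show "a \<in> mset ` {xs. set xs \<subseteq> set_mset m \<and> length xs \<le> size m}"
      by (auto intro!: image_eqI[of _ _ xs])
  qed
  then have "finite ?B"
    using finite_lists_length_le[of "set_mset m" "size m"] finite_surj by blast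
  then show "finite (?B \<times> ?B)"
    by blast
qed

lemma splits_empty [simp]: "splits {#} = {({#}, {#})}"
  by (auto simp: splits_def)

instantiation mfps :: (type, zero) zero
begin
definition zero_mfps :: "('a, 'b) mfps" where
  "zero_mfps = Abs_mfps (\<lambda>_. 0)"
instance ..
end

instantiation mfps :: (type, "{zero, one}") one
begin
definition one_mfps :: "('a, 'b) mfps" where
  "one_mfps = Abs_mfps (\<lambda>m. if m = {#} then 1 else 0)"
instance ..
end

instantiation mfps :: (type, plus) plus
begin
definition plus_mfps :: "('a, 'b) mfps \<Rightarrow> ('a, 'b) mfps \<Rightarrow> ('a, 'b) mfps" where
  "plus_mfps f g = Abs_mfps (\<lambda>m. mfps_coeff f m + mfps_coeff g m)"
instance ..
end

instantiation mfps :: (type, minus) minus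
begin
definition minus_mfps :: "('a, 'b) mfps \<Rightarrow> ('a, 'b) mfps \<Rightarrow> ('a, 'b) mfps" where
  "minus_mfps f g = Abs_mfps (\<lambda>m. mfps_coeff f m - mfps_coeff g m)"
instance ..
end

instantiation mfps :: (type, uminus) uminus
begin
definition uminus_mfps :: "('a, 'b) mfps \<Rightarrow> ('a, 'b) mfps" where
  "uminus_mfps f = Abs_mfps (\<lambda>m. - mfps_coeff f m)"
instance ..
end

instantiation mfps :: (type, comm_semiring_0) times
begin
definition times_mfps :: "('a, 'b) mfps \<Rightarrow> ('a, 'b) mfps \<Rightarrow> ('a, 'b) mfps" where
  "times_mfps f g =
     Abs_mfps (\<lambda>m. \<Sum>(a, b) \<in> splits m. mfps_coeff f a * mfps_coeff g b)"
instance ..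
end

lemma mfps_coeff_zero [simp]: "mfps_coeff 0 m = 0"
  by (simp add: zero_mfps_def)

lemma mfps_coeff_one: "mfps_coeff 1 m = (if m = {#} then 1 else 0)"
  by (simp add: one_mfps_def)

lemma mfps_coeff_add [simp]: "mfps_coeff (f + g) m = mfps_coeff f m + mfps_coeff g m"
  by (simp add: plus_mfps_def)

lemma mfps_coeff_diff [simp]: "mfps_coeff (f - g) m = mfps_coeff f m - mfps_coeff g m"
  by (simp add: minus_mfps_def)

lemma mfps_coeff_uminus [simp]: "mfps_coeff (- f) m = - mfps_coeff f m"
  by (simp add: uminus_mfps_def)

lemma mfps_coeff_mult:
  "mfps_coeff (f * g) m = (\<Sum>(a, b) \<in> splits m. mfps_coeff f a * mfps_coeff g b)"
  by (simp add: times_mfps_def)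

lemma mfps_mult_commute: "f * g = g * (f :: ('v, 'a :: comm_semiring_0) mfps)"
proof (rule mfps_eqI)
  fix m :: "'v multiset"
  have "(\<Sum>(a, b) \<in> splits m. mfps_coeff f a * mfps_coeff g b) =
        (\<Sum>(a, b) \<in> splits m. mfps_coeff g a * mfps_coeff f b)"
    by (rule sum.reindex_bij_witness[of _ "\<lambda>(a, b). (b, a)" "\<lambda>(a, b). (b, a)"])
       (auto simp: splits_def mult.commute add.commute)
  then show "mfps_coeff (f * g) m = mfps_coeff (g * f) m"
    by (simp add: mfps_coeff_mult)
qed

lemma mfps_mult_assoc: "(f * g) * h = f * (g * (h :: ('v, 'a :: comm_semiring_0) mfps))"
proof (rule mfps_eqI)
  fix m :: "'v multiset"
  let ?f = "mfps_coeff f" and ?g = "mfps_coeff g" and ?h = "mfps_coeff h"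
  have "mfps_coeff ((f * g) * h) m =
        (\<Sum>p \<in> splits m. \<Sum>q \<in> splits (fst p). ?f (fst q) * ?g (snd q) * ?h (snd p))"
    by (simp add: mfps_coeff_mult case_prod_unfold sum_distrib_right)
  also have "\<dots> = (\<Sum>(p, q) \<in> (SIGMA p:splits m. splits (fst p)).
                    ?f (fst q) * ?g (snd q) * ?h (snd p))"
    by (rule sum.Sigma) auto
  also have "\<dots> = (\<Sum>(p, q) \<in> (SIGMA p:splits m. splits (snd p)).
                    ?f (fst p) * (?g (fst q) * ?h (snd q)))"
    by (rule sum.reindex_bij_witness[of _
          "\<lambda>((a, d), (b, c)). ((a + b, c), (a, b))" "\<lambda>((d, c), (a, b)). ((a, b + c), (b, c))"])
       (auto simp: splits_def ac_simps)
  also have "\<dots> = (\<Sum>p \<in> splits m. \<Sum>q \<in> splits (snd p). ?f (fst p) * (?g (fst q) * ?h (snd q)))"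
    by (rule sum.Sigma[symmetric]) auto
  also have "\<dots> = mfps_coeff (f * (g * h)) m"
    by (simp add: mfps_coeff_mult case_prod_unfold sum_distrib_left)
  finally show "mfps_coeff ((f * g) * h) m = mfps_coeff (f * (g * h)) m" .
qed

lemma mfps_one_mult: "1 * f = (f :: ('v, 'a :: comm_semiring_1) mfps)"
proof (rule mfps_eqI)
  fix m :: "'v multiset"
  have "mfps_coeff (1 * f) m = (\<Sum>p \<in> splits m. if p = ({#}, m) then mfps_coeff f m else 0)"
    unfolding mfps_coeff_mult by (rule sum.cong) (auto simp: splits_def mfps_coeff_one split: if_splits)
  also have "\<dots> = mfps_coeff f m"
    by (subst sum.delta[OF finite_splits]) (auto simp: splits_def)
  finally show "mfps_coeff (1 * f) m = mfps_coeff f m" .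
qed

instance mfps :: (type, comm_ring_1) comm_ring_1
proof
  fix a b c :: "('a, 'b) mfps"
  show "a + b + c = a + (b + c)" "a + b = b + a" "0 + a = a" "- a + a = 0" "a - b = a + - b"
    by (rule mfps_eqI; simp)+
  show "a * b * c = a * (b * c)" "a * b = b * a" "1 * a = a"
    by (rule mfps_mult_assoc mfps_mult_commute mfps_one_mult)+
  show "(a + b) * c = a * c + b * c"
    by (rule mfps_eqI) (simp add: mfps_coeff_mult case_prod_unfold distrib_right sum.distrib)
  show "0 \<noteq> (1 :: ('a, 'b) mfps)"
  proof
    assume "0 = (1 :: ('a, 'b) mfps)"
    then show False
      using mfps_coeff_zero[of "{#}"] mfps_coeff_one[of "{#}"] by (metis zero_neq_one)
  qed
qed

text \<open>
  A well-order of the variables induces a well-order of the monomials that is compatible with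
  multiplication, and the product of the two least terms does not cancel.
\<close>

instance mfps :: (wellorder, idom) idom
proof
  fix f g :: "('a, 'b) mfps"
  assume "f \<noteq> 0" "g \<noteq> 0"
  then obtain a0 b0 where nz: "mfps_coeff f a0 \<noteq> 0" "mfps_coeff g b0 \<noteq> 0"
    by (metis mfps_eqI mfps_coeff_zero)
  define a where "a = (LEAST m. mfps_coeff f m \<noteq> 0)"
  define b where "b = (LEAST m. mfps_coeff g m \<noteq> 0)"
  have a: "mfps_coeff f a \<noteq> 0" "\<And>m. mfps_coeff f m \<noteq> 0 \<Longrightarrow> a \<le> m"
    unfolding a_def using nz(1) by (rule LeastI, auto intro: Least_le)
  have b: "mfps_coeff g b \<noteq> 0" "\<And>m. mfps_coeff g m \<noteq> 0 \<Longrightarrow> b \<le> m"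
    unfolding b_def using nz(2) by (rule LeastI, auto intro: Least_le)
  have "mfps_coeff (f * g) (a + b) =
        (\<Sum>p \<in> splits (a + b). if p = (a, b) then mfps_coeff f a * mfps_coeff g b else 0)"
    unfolding mfps_coeff_mult
  proof (rule sum.cong[OF refl])
    fix p assume "p \<in> splits (a + b)"
    then obtain c d where p: "p = (c, d)" "c + d = a + b"
      by (auto simp: splits_def)
    have "c = a \<and> d = b" if "mfps_coeff f c \<noteq> 0" "mfps_coeff g d \<noteq> 0"
    proof -
      have "a \<le> c" "b \<le> d"
        using a(2) b(2) that by auto
      moreover have "\<not> a < c"
        using add_less_le_mono[of a c b d] \<open>b \<le> d\<close> p(2) by auto
      ultimately show ?thesis
        using p(2) by auto
    qed
    then show "(case p of (x, y) \<Rightarrow> mfps_coeff f x * mfps_coeff g y) =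
               (if p = (a, b) then mfps_coeff f a * mfps_coeff g b else 0)"
      using p(1) by auto
  qed
  also have "\<dots> = mfps_coeff f a * mfps_coeff g b"
    by (subst sum.delta[OF finite_splits]) (auto simp: splits_def)
  finally show "f * g \<noteq> 0"
    using a(1) b(1) by auto
qed

definition mfps_const :: "'a \<Rightarrow> ('v, 'a :: zero) mfps" where
  "mfps_const c = Abs_mfps (\<lambda>m. if m = {#} then c else 0)"

definition mfps_var :: "'v \<Rightarrow> ('v, 'a :: {zero, one}) mfps" where
  "mfps_var v = Abs_mfps (\<lambda>m. if m = {#v#} then 1 else 0)"

text \<open>
  Infinite sums are coefficientwise: every monomial occurs in only finitely many summands.
\<close>

definition mfps_has_sum ::
    "('i \<Rightarrow> ('v, 'a :: comm_monoid_add) mfps) \<Rightarrow> 'i set \<Rightarrow> ('v, 'a) mfps \<Rightarrow> bool" where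
  "mfps_has_sum f A S \<longleftrightarrow>
     (\<forall>m. finite {i \<in> A. mfps_coeff (f i) m \<noteq> 0} \<and>
          mfps_coeff S m = (\<Sum>i | i \<in> A \<and> mfps_coeff (f i) m \<noteq> 0. mfps_coeff (f i) m))"

text \<open>
  Quotients are taken in the field of fractions of the ring of power series.  A family in that
  field is summed as a family of power series; all its members must lie in the subring
  of power series.
\<close>

definition fract_has_sum ::
    "('i \<Rightarrow> ('v :: wellorder, 'a :: idom) mfps fract) \<Rightarrow> 'i set \<Rightarrow> ('v, 'a) mfps fract \<Rightarrow> bool" where
  "fract_has_sum f A s \<longleftrightarrow>
     (\<exists>g S. (\<forall>i\<in>A. f i = to_fract (g i)) \<and> mfps_has_sum g A S \<and> s = to_fract S)"


text \<open>
  In the field of fractions \<open>1 / (1 - z)\<close> is the geometric series in \<open>z\<close>, for every power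
  series \<open>z\<close> without constant term.
\<close>

lemma mfps_coeff_power_eq_0:
  fixes z :: "('v, 'a :: comm_ring_1) mfps"
  assumes "mfps_coeff z {#} = 0" "size m < k"
  shows "mfps_coeff (z ^ k) m = 0"
  using assms(2)
proof (induction k arbitrary: m)
  case (Suc k)
  have "mfps_coeff z a * mfps_coeff (z ^ k) b = 0" if "(a, b) \<in> splits m" for a b
  proof (cases "a = {#}")
    case False
    then have "0 < size a"
      by (simp add: nonempty_has_size)
    moreover have "size m = size a + size b"
      using that by (auto simp: splits_def)
    ultimately show ?thesis
      using Suc by auto
  qed (use assms(1) in simp)
  then show ?case
    by (auto simp: mfps_coeff_mult intro!: sum.neutral)
qed simp

lemma mfps_geometric:
  fixes z :: "('v, 'a :: comm_ring_1) mfps"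
  assumes z: "mfps_coeff z {#} = 0"
  obtains S where "mfps_has_sum (\<lambda>k. z ^ k) UNIV S" and "(1 - z) * S = 1"
proof -
  define S where "S = Abs_mfps (\<lambda>m. \<Sum>k\<le>size m. mfps_coeff (z ^ k) m)"
  have coeff_S: "mfps_coeff S m = (\<Sum>k\<le>size m. mfps_coeff (z ^ k) m)" for m
    by (simp add: S_def Abs_mfps_inverse)
  have sub: "{k \<in> UNIV. mfps_coeff (z ^ k) m \<noteq> 0} \<subseteq> {..size m}" for m
    using mfps_coeff_power_eq_0[OF z, of m] by (auto simp: not_less[symmetric])
  have "mfps_has_sum (\<lambda>k. z ^ k) UNIV S"
    unfolding mfps_has_sum_def
  proof (intro allI conjI)
    fix m :: "'v multiset"
    show "finite {k \<in> UNIV. mfps_coeff (z ^ k) m \<noteq> 0}"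
      using sub[of m] finite_subset by blast
    show "mfps_coeff S m =
          (\<Sum>k | k \<in> UNIV \<and> mfps_coeff (z ^ k) m \<noteq> 0. mfps_coeff (z ^ k) m)"
      unfolding coeff_S by (rule sum.mono_neutral_right) (use sub[of m] in auto)
  qed
  moreover have "(1 - z) * S = 1"
  proof (rule mfps_eqI)
    fix m :: "'v multiset"
    define P where "P = (\<Sum>k\<le>size m. z ^ k)"
    have coeff_sum: "mfps_coeff (\<Sum>k\<in>B. z ^ k) b = (\<Sum>k\<in>B. mfps_coeff (z ^ k) b)"
      if "finite B" for B :: "nat set" and b
      using that by induction auto
    have "mfps_coeff S b = mfps_coeff P b" if "size b \<le> size m" for b
    proof -
      have "mfps_coeff P b = (\<Sum>k\<le>size m. mfps_coeff (z ^ k) b)"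
        by (simp add: P_def coeff_sum)
      also have "\<dots> = mfps_coeff S b"
        unfolding coeff_S
        by (rule sum.mono_neutral_right) (use sub[of b] that in auto)
      finally show ?thesis ..
    qed
    then have "mfps_coeff ((1 - z) * S) m = mfps_coeff ((1 - z) * P) m"
      unfolding mfps_coeff_mult by (intro sum.cong) (auto simp: splits_def)
    also have "(1 - z) * P = 1 - z ^ Suc (size m)"
      by (simp add: P_def one_diff_power_eq lessThan_Suc_atMost del: power_Suc)
    also have "mfps_coeff \<dots> m = mfps_coeff 1 m"
      using mfps_coeff_power_eq_0[OF z, of m "Suc (size m)"] by simp
    finally show "mfps_coeff ((1 - z) * S) m = mfps_coeff 1 m" .
  qed
  ultimately show ?thesis
    by (rule that)
qed

lemma to_fract_power: "to_fract (x ^ k) = to_fract x ^ k"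
  by (induction k) auto

lemma fract_geometric:
  fixes z :: "('v :: wellorder, 'a :: idom) mfps"
  assumes "mfps_coeff z {#} = 0"
  shows "fract_has_sum (\<lambda>k. to_fract z ^ k) UNIV (1 / (1 - to_fract z))"
proof -
  obtain S where S: "mfps_has_sum (\<lambda>k. z ^ k) UNIV S" "(1 - z) * S = 1"
    using mfps_geometric[OF assms] .
  have "to_fract ((1 - z) * S) = 1"
    by (simp only: S(2) to_fract_1)
  then have "(1 - to_fract z) * to_fract S = 1"
    by (simp only: to_fract_mult to_fract_diff to_fract_1)
  then have "1 / (1 - to_fract z) = to_fract S"
    by (metis divide_eq_eq mult.commute mult_zero_left zero_neq_one)
  then show ?thesis
    unfolding fract_has_sum_def using S(1) to_fract_power by metis
qed


section \<open>Indeterminates, partitions and Schur polynomials\<close>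

text \<open>
  The ambient field consists of the fractions of power series in countably many variables over
  \<open>'a[t]\<close>.  The even-numbered variables are called \<open>x\<^sub>i\<close>, the odd-numbered ones \<open>y\<^sub>i\<close>.
\<close>

type_synonym 'a series_fract = "(nat, 'a poly) mfps fract"

definition indet_t :: "'a :: idom series_fract" where
  "indet_t = to_fract (mfps_const [:0, 1:])"

definition indet_x :: "nat \<Rightarrow> 'a :: idom series_fract" where
  "indet_x i = to_fract (mfps_var (2 * i))"

definition indet_y :: "nat \<Rightarrow> 'a :: idom series_fract" where
  "indet_y i = to_fract (mfps_var (2 * i + 1))"

definition is_partition :: "nat list \<Rightarrow> bool" where
  "is_partition l \<longleftrightarrow> sorted_wrt (\<ge>) l \<and> (\<forall>p\<in>set l. 0 < p)"

text \<open>\<open>part l i\<close> is the \<open>i\<close>-th part, counted from \<open>1\<close> and padded with zeros.\<close>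

definition part :: "nat list \<Rightarrow> nat \<Rightarrow> nat" where
  "part l i = (if 1 \<le> i \<and> i \<le> length l then l ! (i - 1) else 0)"

definition vandermonde :: "nat \<Rightarrow> (nat \<Rightarrow> 'a) \<Rightarrow> 'a :: comm_ring_1" where
  "vandermonde n x = (\<Prod>i\<in>{1..n}. \<Prod>j\<in>{i<..n}. (x i - x j))"

text \<open>
  Matrices of the library are indexed from \<open>0\<close>; \<open>mat1 n a\<close> is the \<open>n \<times> n\<close> matrix with entries
  \<open>a i j\<close> for \<open>1 \<le> i, j \<le> n\<close>.
\<close>

definition mat1 :: "nat \<Rightarrow> (nat \<Rightarrow> nat \<Rightarrow> 'a) \<Rightarrow> 'a mat" where
  "mat1 n a = mat n n (\<lambda>(i, j). a (i + 1) (j + 1))"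

text \<open>
  The exponents \<open>\<lambda>\<^sub>j - j + n\<close> are written with the subtraction last, so that truncated
  subtraction on \<open>nat\<close> is exact for \<open>j \<le> n\<close>.
\<close>

definition schur :: "nat \<Rightarrow> nat list \<Rightarrow> (nat \<Rightarrow> 'a) \<Rightarrow> 'a :: field" where
  "schur n l x = det (mat1 n (\<lambda>i j. x i ^ (part l j + n - j))) / vandermonde n x"

end

theory Submission
  imports Defs "HOL-Library.FuncSet"
begin

text \<open>
  Since \<open>(1 - t) / ((1 - z) (1 - t z)) = \<Sum>k. (1 - t\<^sup>k\<^sup>+\<^sup>1) z\<^sup>k\<close>, the matrix on the right-hand side is
  the product of \<open>((1 - t\<^sup>k\<^sup>+\<^sup>1) x\<^sub>i\<^sup>k)\<close> and \<open>(y\<^sub>j\<^sup>k)\<close>, and the Cauchy--Binet formula expands its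
  determinant over the strictly decreasing sequences \<open>k\<^sub>i = \<lambda>\<^sub>i + n - i\<close>.  To stay with finite
  matrices, the series are truncated and the identity is shown modulo power series without terms
  of degree below \<open>d\<close>, for every \<open>d\<close>.  Newton interpolation of \<open>z\<^sup>k\<close> at \<open>x\<^sub>1, \<dots>, x\<^sub>n\<close> factors every
  alternant as the Vandermonde product times a determinant of complete homogeneous polynomials;
  this shows that the Schur quotients are power series and that they vanish below degree \<open>\<lambda>\<^sub>1\<close>.
\<close>

section \<open>Shifted partitions and the Cauchy--Binet formula\<close>

text \<open>The exponent in column \<open>i + 1\<close> of the alternant: indices count from 0 here,
  whereas \<open>part\<close> counts from 1. The subtraction comes last and is exact for
  \<open>i < n\<close>.\<close>

definition shifted_part :: "nat \<Rightarrow> nat list \<Rightarrow> nat \<Rightarrow> nat" where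
  "shifted_part n l i = part l (Suc i) + n - Suc i"

section \<open>Partitions and strictly decreasing exponent sequences\<close>

lemma part_antimono:
  assumes "is_partition l" "1 \<le> i" "i \<le> j"
  shows "part l j \<le> part l i"
proof (cases "i < j \<and> j \<le> length l")
  case True
  then show ?thesis
    using assms unfolding is_partition_def part_def
    by (auto simp: sorted_wrt_iff_nth_less)
next
  case False
  then show ?thesis
    using assms by (auto simp: part_def)
qed

lemma part_pos_iff:
  assumes "is_partition l"
  shows "0 < part l i \<longleftrightarrow> i \<in> {1..length l}"
  using assms unfolding is_partition_def part_def by (auto simp: in_set_conv_nth)

lemma partition_eqI:
  assumes "is_partition l" "is_partition l'" "\<And>i. part l i = part l' i"
  shows "l = l'"
proof (rule nth_equalityI)
  \<comment> \<open>Padding hides the length; it is recovered as the number of positive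
    parts.\<close>
  have "{1..length l} = {1..length l'}"
    unfolding set_eq_iff part_pos_iff[OF assms(1), symmetric] part_pos_iff[OF assms(2), symmetric]
    by (simp add: assms(3))
  then have "card {1..length l} = card {1..length l'}"
    by (simp only:)
  then show len: "length l = length l'"
    by (simp only: card_atLeastAtMost diff_Suc_1)
  show "l ! i = l' ! i" if "i < length l" for i
    using assms(3)[of "Suc i"] that len by (simp add: part_def)
qed

lemma shifted_part_strict_antimono:
  assumes "is_partition l" "i < j" "j < n"
  shows "shifted_part n l j < shifted_part n l i"
  using part_antimono[OF assms(1), of "Suc i" "Suc j"] assms(2,3)
  by (simp add: shifted_part_def)

lemma shifted_part_inj_on:
  assumes "is_partition l"
  shows "inj_on (shifted_part n l) {0..<n}"
proof (rule inj_onI)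
  fix i j assume "i \<in> {0..<n}" "j \<in> {0..<n}" "shifted_part n l i = shifted_part n l j"
  then show "i = j"
    using shifted_part_strict_antimono[OF assms, of i j n]
      shifted_part_strict_antimono[OF assms, of j i n]
    by (cases i j rule: linorder_cases) simp_all
qed

lemma shifted_part_eqD:
  assumes "is_partition l" "length l \<le> n" "is_partition l'" "length l' \<le> n"
    and eq: "\<And>i. i < n \<Longrightarrow> shifted_part n l i = shifted_part n l' i"
  shows "l = l'"
proof (rule partition_eqI[OF assms(1,3)])
  show "part l i = part l' i" for i
  proof (cases "1 \<le> i \<and> i \<le> n")
    case True
    then have "i - 1 < n" "Suc (i - 1) = i"
      by auto
    then show ?thesis
      using eq[of "i - 1"] True by (simp add: shifted_part_def)
  next
    case False
    then have "\<not> (1 \<le> i \<and> i \<le> length l)" "\<not> (1 \<le> i \<and> i \<le> length l')"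
      using assms(2,4) by auto
    then show ?thesis
      unfolding part_def by (simp only: if_False)
  qed
qed

text \<open>Subtracting the staircase \<open>n - 1, ..., 0\<close> inverts the shift. The rest is
  weakly decreasing, and its final zeros are cut off because a partition has positive entries
  only.\<close>

lemma ex_partition_shifted_part:
  fixes e :: "nat \<Rightarrow> nat"
  assumes e: "\<And>i j. i < j \<Longrightarrow> j < n \<Longrightarrow> e j < e i"
  shows "\<exists>l. is_partition l \<and> length l \<le> n \<and> (\<forall>i<n. shifted_part n l i = e i)"
proof -
  \<comment> \<open>Strict descent on naturals loses at least one per index, so the truncated
    subtraction in \<open>p\<close> is exact and \<open>p\<close> is weakly decreasing.\<close>
  have gap: "e j + (j - i) \<le> e i" if "i \<le> j" "j < n" for i j
    using that
  proof (induction j rule: dec_induct)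
    case (step j)
    then show ?case
      using e[of j "Suc j"] by auto
  qed simp
  define p where "p i = e i - (n - Suc i)" for i
  have e_eq: "e i = p i + (n - Suc i)" if "i < n" for i
  proof -
    have "e (n - 1) + (n - 1 - i) \<le> e i"
      using that by (intro gap) auto
    then show ?thesis
      by (simp add: p_def)
  qed
  have p_anti: "p j \<le> p i" if "i \<le> j" "j < n" for i j
    using gap[OF that] that by (auto simp: p_def)
  \<comment> \<open>The first zero of \<open>p\<close>, or \<open>n\<close> if there is none before;
    the disjunct \<open>n \<le> k\<close> makes the minimum exist.\<close>
  define k where "k = (LEAST k. n \<le> k \<or> p k = 0)"
  have k: "n \<le> k \<or> p k = 0"
    unfolding k_def by (rule LeastI[of _ n]) simp
  have "k \<le> n"
    unfolding k_def by (rule Least_le) simp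
  have below: "0 < p i" if "i < k" for i
    using not_less_Least[of i "\<lambda>k. n \<le> k \<or> p k = 0"] that unfolding k_def by auto
  show ?thesis
  proof (intro exI conjI allI impI)
    show "is_partition (map p [0..<k])"
      unfolding is_partition_def sorted_wrt_iff_nth_less
      using \<open>k \<le> n\<close> by (simp add: below p_anti)
    show "length (map p [0..<k]) \<le> n"
      using \<open>k \<le> n\<close> by simp
    show "shifted_part n (map p [0..<k]) i = e i" if "i < n" for i
    proof -
      have "part (map p [0..<k]) (Suc i) = p i"
      proof (cases "i < k")
        case False
        then have "p k = 0" "p i \<le> p k"
          using k p_anti[of k i] that by auto
        then show ?thesis
          using False by (simp add: part_def)
      qed (simp add: part_def)
      then show ?thesis
        using e_eq[OF that] that by (simp add: shifted_part_def)
    qed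
  qed
qed

text \<open>Reversed, both sequences are strictly increasing lists, and such a list is determined by
  its set of entries.\<close>

lemma strict_antimono_unique:
  fixes e e' :: "nat \<Rightarrow> nat"
  assumes "\<And>i j. i < j \<Longrightarrow> j < n \<Longrightarrow> e j < e i" "\<And>i j. i < j \<Longrightarrow> j < n \<Longrightarrow> e' j < e' i"
    and "e ` {0..<n} = e' ` {0..<n}" "i < n"
  shows "e i = e' i"
proof -
  have "map e (rev [0..<n]) = map e' (rev [0..<n])"
    by (rule strict_sorted_equal)
       (use assms in \<open>auto simp: sorted_wrt_map sorted_wrt_rev sorted_wrt_iff_nth_less rev_nth\<close>)
  then show ?thesis
    using assms(4) by simp
qed

text \<open>Sorting decreasingly splits an injective sequence uniquely into a partition and a permutation.\<close>

lemma bij_betw_partition_permutation: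
  "bij_betw (\<lambda>(l, p). \<lambda>i\<in>{0..<n}. shifted_part n l (p i))
     ({l. is_partition l \<and> length l \<le> n \<and> (\<forall>i<n. shifted_part n l i < N)} \<times>
      {p. p permutes {0..<n}})
     {f \<in> {0..<n} \<rightarrow>\<^sub>E {0..<N}. inj_on f {0..<n}}"
  (is "bij_betw ?F (?L \<times> ?P) ?I")
proof (rule bij_betwI')
  fix u v assume "u \<in> ?L \<times> ?P" "v \<in> ?L \<times> ?P"
  then obtain l p l' p' where u: "u = (l, p)" and v: "v = (l', p')"
    and l: "is_partition l" "length l \<le> n" and l': "is_partition l'" "length l' \<le> n"
    and p: "p permutes {0..<n}" and p': "p' permutes {0..<n}"
    by auto
  show "?F u = ?F v \<longleftrightarrow> u = v"
  proof
    assume "?F u = ?F v"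
    then have eq: "shifted_part n l (p i) = shifted_part n l' (p' i)" if "i \<in> {0..<n}" for i
      using that unfolding u v by (auto simp: restrict_def fun_eq_iff split: if_splits)
    have "shifted_part n l ` p ` {0..<n} = shifted_part n l' ` p' ` {0..<n}"
      using eq by (auto simp: image_image)
    \<comment> \<open>Permuting the indices keeps the image, and the image determines
      \<open>l\<close>; injectivity of the shifted parts then gives the permutation.\<close>
    then have img: "shifted_part n l ` {0..<n} = shifted_part n l' ` {0..<n}"
      using p p' by (simp add: permutes_image)
    have "l = l'"
      by (rule shifted_part_eqD[OF l l'], rule strict_antimono_unique[of n])
         (use img l l' shifted_part_strict_antimono in auto)
    have "p i = p' i" for i
    proof (cases "i \<in> {0..<n}")
      case True
      then show ?thesis
        using eq[OF True] shifted_part_inj_on[OF l(1), of n] permutes_in_image[OF p, of i]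
          permutes_in_image[OF p', of i] \<open>l = l'\<close> by (auto dest: inj_onD)
    next
      case False
      then show ?thesis
        using p p' by (simp add: permutes_not_in)
    qed
    with \<open>l = l'\<close> show "u = v"
      unfolding u v by auto
  qed simp
next
  fix u assume "u \<in> ?L \<times> ?P"
  then obtain l p where u: "u = (l, p)" and l: "is_partition l" "\<forall>i<n. shifted_part n l i < N"
    and p: "p permutes {0..<n}"
    by auto
  have "inj_on (shifted_part n l \<circ> p) {0..<n}"
    using shifted_part_inj_on[OF l(1)] p
    by (intro comp_inj_on) (auto simp: permutes_inj_on permutes_image)
  then have "inj_on (?F u) {0..<n}"
    unfolding u by (auto simp: inj_on_def)
  then show "?F u \<in> ?I"
    unfolding u using l(2) permutes_in_image[OF p] by auto
next
  fix f assume f: "f \<in> ?I"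
  \<comment> \<open>Surjectivity: the values of \<open>f\<close> in decreasing order become the
    shifted parts of \<open>l\<close>, and \<open>p\<close> sends \<open>i\<close> to the place of
    \<open>f i\<close> in that order.\<close>
  define T where "T = f ` {0..<n}"
  have T: "finite T" "card T = n"
    using f by (auto simp: T_def card_image)
  define e where "e i = rev (sorted_list_of_set T) ! i" for i
  have e_less: "e j < e i" if "i < j" "j < n" for i j
  proof -
    have "sorted_wrt (<) (sorted_list_of_set T)"
      by (rule strict_sorted_list_of_set)
    then have "sorted_wrt (>) (rev (sorted_list_of_set T))"
      by (simp add: sorted_wrt_rev)
    then show ?thesis
      using that T by (simp add: e_def sorted_wrt_iff_nth_less)
  qed
  have e_img: "e ` {0..<n} = T"
    using T nth_image[of n "rev (sorted_list_of_set T)"] by (simp add: e_def[abs_def])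
  obtain l where l: "is_partition l" "length l \<le> n" "\<forall>i<n. shifted_part n l i = e i"
    using ex_partition_shifted_part[of n e] e_less by blast
  have bl: "bij_betw (shifted_part n l) {0..<n} T"
    using shifted_part_inj_on[OF l(1)] e_img l(3) by (auto simp: bij_betw_def)
  \<comment> \<open>Fixing the indices from \<open>n\<close> on is what \<open>permutes\<close>
    demands.\<close>
  define p where "p i = (if i < n then the_inv_into {0..<n} (shifted_part n l) (f i) else i)" for i
  have "bij_betw f {0..<n} T"
    using f by (simp add: T_def bij_betw_def)
  then have "bij_betw (the_inv_into {0..<n} (shifted_part n l) \<circ> f) {0..<n} {0..<n}"
    using bij_betw_the_inv_into[OF bl] by (rule bij_betw_trans)
  then have "bij_betw p {0..<n} {0..<n}"
    by (subst bij_betw_cong[where g = "the_inv_into {0..<n} (shifted_part n l) \<circ> f"])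
       (auto simp: p_def)
  then have p: "p permutes {0..<n}"
    by (rule bij_imp_permutes) (auto simp: p_def)
  have pf: "shifted_part n l (p i) = f i" if "i < n" for i
    using f_the_inv_into_f_bij_betw[OF bl, of "f i"] that by (auto simp: p_def T_def)
  have "shifted_part n l i < N" if "i < n" for i
  proof -
    have "shifted_part n l i \<in> T"
      using bl that by (auto simp: bij_betw_def)
    then show ?thesis
      using f by (auto simp: T_def)
  qed
  then have "(l, p) \<in> ?L \<times> ?P"
    using l p by auto
  moreover have "f = ?F (l, p)"
    using pf f by (auto simp: fun_eq_iff restrict_def PiE_def extensional_def)
  ultimately show "\<exists>u\<in>?L \<times> ?P. f = ?F u"
    by blast
qed

section \<open>Cauchy-Binet expansion\<close>

text \<open>Multilinearity in the rows: multiplying out the sums picks an index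
  \<open>k = f i\<close> for every row \<open>i\<close>.\<close>

lemma det_mat_sum:
  fixes a b :: "nat \<Rightarrow> nat \<Rightarrow> 'a :: comm_ring_1"
  shows "det (mat n n (\<lambda>(i, j). \<Sum>k<N. a i k * b k j)) =
    (\<Sum>f\<in>{0..<n} \<rightarrow>\<^sub>E {0..<N}. (\<Prod>i=0..<n. a i (f i)) * det (mat n n (\<lambda>(i, j). b (f i) j)))"
proof -
  have "det (mat n n (\<lambda>(i, j). \<Sum>k<N. a i k * b k j)) =
      (\<Sum>p | p permutes {0..<n}. signof p * (\<Prod>i=0..<n. \<Sum>k\<in>{0..<N}. a i k * b k (p i)))"
    unfolding det_def by (auto simp: atLeast0LessThan intro!: sum.cong prod.cong)
  also have "\<dots> = (\<Sum>p | p permutes {0..<n}. \<Sum>f\<in>{0..<n} \<rightarrow>\<^sub>E {0..<N}.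
      (\<Prod>i=0..<n. a i (f i)) * (signof p * (\<Prod>i=0..<n. b (f i) (p i))))"
    by (simp add: prod_sum_PiE sum_distrib_left prod.distrib mult_ac)
  also have "\<dots> = (\<Sum>f\<in>{0..<n} \<rightarrow>\<^sub>E {0..<N}. \<Sum>p | p permutes {0..<n}.
      (\<Prod>i=0..<n. a i (f i)) * (signof p * (\<Prod>i=0..<n. b (f i) (p i))))"
    by (rule sum.swap)
  also have "\<dots> = (\<Sum>f\<in>{0..<n} \<rightarrow>\<^sub>E {0..<N}.
      (\<Prod>i=0..<n. a i (f i)) * det (mat n n (\<lambda>(i, j). b (f i) j)))"
    unfolding det_def by (auto simp: sum_distrib_left intro!: sum.cong prod.cong)
  finally show ?thesis .
qed

text \<open>A choice \<open>f\<close> with a repeated value gives equal rows and drops out. Every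
  other \<open>f\<close> sorts into a partition and a permutation, and summing over the permutations
  reassembles the determinant of \<open>a\<close>.\<close>

lemma cauchy_binet_partitions:
  fixes a b :: "nat \<Rightarrow> nat \<Rightarrow> 'a :: comm_ring_1"
  shows "det (mat n n (\<lambda>(i, j). \<Sum>k<N. a i k * b k j)) =
    (\<Sum>l | is_partition l \<and> length l \<le> n \<and> (\<forall>i<n. shifted_part n l i < N).
       det (mat n n (\<lambda>(i, j). a i (shifted_part n l j))) *
       det (mat n n (\<lambda>(i, j). b (shifted_part n l i) j)))"
proof -
  let ?L = "{l. is_partition l \<and> length l \<le> n \<and> (\<forall>i<n. shifted_part n l i < N)}"
  let ?P = "{p. p permutes {0..<n}}"
  let ?I = "{f \<in> {0..<n} \<rightarrow>\<^sub>E {0..<N}. inj_on f {0..<n}}"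
  let ?B = "\<lambda>f. mat n n (\<lambda>(i, j). b (f i) j)"
  let ?g = "\<lambda>f. (\<Prod>i=0..<n. a i (f i)) * det (?B f)"
  have "det (?B f) = 0" if not_inj: "\<not> inj_on f {0..<n}" for f
  proof -
    obtain i j where "i < n" "j < n" "i \<noteq> j" "f i = f j"
      using not_inj by (auto simp: inj_on_def)
    then show ?thesis
      by (intro det_identical_rows[of _ n i j]) auto
  qed
  then have "det (mat n n (\<lambda>(i, j). \<Sum>k<N. a i k * b k j)) = (\<Sum>f\<in>?I. ?g f)"
    unfolding det_mat_sum by (intro sum.mono_neutral_right) (auto intro!: finite_PiE)
  also have "\<dots> = (\<Sum>u\<in>?L \<times> ?P. ?g ((\<lambda>(l, p). \<lambda>i\<in>{0..<n}. shifted_part n l (p i)) u))"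
    by (rule sum.reindex_bij_betw[OF bij_betw_partition_permutation, symmetric])
  also have "\<dots> = (\<Sum>(l, p)\<in>?L \<times> ?P. signof p * (\<Prod>i=0..<n. a i (shifted_part n l (p i))) *
      det (?B (shifted_part n l)))"
  proof (rule sum.cong[OF refl])
    fix u assume "u \<in> ?L \<times> ?P"
    then obtain l p where u: "u = (l, p)" and p: "p permutes {0..<n}"
      by auto
    define f where "f = (\<lambda>i\<in>{0..<n}. shifted_part n l (p i))"
    have f: "f i = shifted_part n l (p i)" "p i < n" if "i < n" for i
      using permutes_in_image[OF p, of i] that by (simp_all add: f_def)
    \<comment> \<open>Row \<open>i\<close> for \<open>f\<close> is row \<open>p i\<close> of the
      sorted matrix, so only the sign of \<open>p\<close> separates the determinants.\<close>
    have "?B f = mat n n (\<lambda>(i, j). ?B (shifted_part n l) $$ (p i, j))"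
      using f by (intro eq_matI) auto
    then have "det (?B f) = signof p * det (?B (shifted_part n l))"
      using det_permute_rows[OF _ p, of "?B (shifted_part n l)"] by simp
    moreover have "(\<Prod>i=0..<n. a i (f i)) = (\<Prod>i=0..<n. a i (shifted_part n l (p i)))"
      using f by (intro prod.cong) auto
    ultimately have "?g f = signof p * (\<Prod>i=0..<n. a i (shifted_part n l (p i))) *
        det (?B (shifted_part n l))"
      by (simp only: mult_ac)
    then show "?g ((\<lambda>(l, p). \<lambda>i\<in>{0..<n}. shifted_part n l (p i)) u) =
        (case u of (l, p) \<Rightarrow> signof p * (\<Prod>i=0..<n. a i (shifted_part n l (p i))) *
          det (?B (shifted_part n l)))"
      by (simp only: u f_def case_prod_conv)
  qed
  also have "\<dots> = (\<Sum>l\<in>?L. \<Sum>p\<in>?P. signof p * (\<Prod>i=0..<n. a i (shifted_part n l (p i))) *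
      det (?B (shifted_part n l)))"
    by (rule sum.cartesian_product[symmetric])
  also have "\<dots> = (\<Sum>l\<in>?L. det (mat n n (\<lambda>(i, j). a i (shifted_part n l j))) *
      det (?B (shifted_part n l)))"
  proof (rule sum.cong[OF refl])
    fix l
    have "det (mat n n (\<lambda>(i, j). a i (shifted_part n l j))) =
        (\<Sum>p\<in>?P. signof p * (\<Prod>i=0..<n. a i (shifted_part n l (p i))))"
      unfolding det_def by (auto intro!: sum.cong prod.cong arg_cong2[where f = "(*)"])
    then show "(\<Sum>p\<in>?P. signof p * (\<Prod>i=0..<n. a i (shifted_part n l (p i))) *
        det (?B (shifted_part n l))) =
      det (mat n n (\<lambda>(i, j). a i (shifted_part n l j))) * det (?B (shifted_part n l))"
      by (simp only: sum_distrib_right)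
  qed
  finally show ?thesis .
qed


section \<open>Alternants\<close>

text \<open>\<open>newton_coeff x k i\<close> is \<open>(-1) ^ i\<close> times the complete homogeneous symmetric
  polynomial of degree \<open>k - i\<close> in \<open>x 0, \<dots>, x i\<close> (zero if \<open>k < i\<close>): the coefficient of
  \<open>\<Prod>m<i. x m - z\<close> in the Newton interpolation of \<open>z ^ k\<close>.\<close>

primrec newton_coeff :: "(nat \<Rightarrow> 'a :: comm_ring_1) \<Rightarrow> nat \<Rightarrow> nat \<Rightarrow> 'a" where
  "newton_coeff x 0 i = (if i = 0 then 1 else 0)"
| "newton_coeff x (Suc k) i =
     x i * newton_coeff x k i - (case i of 0 \<Rightarrow> 0 | Suc j \<Rightarrow> newton_coeff x k j)"

text \<open>Writing \<open>N i\<close> for \<open>\<Prod>m<i. x m - z\<close>, the relation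
  \<open>z * N i = x i * N i - N (Suc i)\<close> turns the expansion of \<open>z ^ k\<close> into
  that of \<open>z ^ Suc k\<close>. At \<open>z = x r\<close> the product \<open>N n\<close>
  vanishes, so \<open>n\<close> terms suffice.\<close>

lemma newton_interpolation:
  fixes x :: "nat \<Rightarrow> 'a :: comm_ring_1"
  assumes "r < n"
  shows "x r ^ k = (\<Sum>i<n. (\<Prod>m<i. x m - x r) * newton_coeff x k i)"
proof (induction k)
  case 0
  have "(\<Sum>i<n. (\<Prod>m<i. x m - x r) * newton_coeff x 0 i) =
      (\<Sum>i<n. if i = 0 then \<Prod>m<i. x m - x r else 0)"
    by (rule sum.cong) auto
  then show ?case
    using assms by simp
next
  case (Suc k)
  let ?N = "\<lambda>i. \<Prod>m<i. x m - x r" and ?H = "newton_coeff x k"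
  have vanish: "?N n = 0"
    using assms by (intro prod_zero) auto
  obtain n' where n: "n = Suc n'"
    using assms by (cases n) auto
  have "(\<Sum>i<n. ?N i * newton_coeff x (Suc k) i) =
      (\<Sum>i<n. x i * ?N i * ?H i) - (\<Sum>i<n. ?N i * (case i of 0 \<Rightarrow> 0 | Suc j \<Rightarrow> ?H j))"
    by (simp add: algebra_simps sum_subtractf)
  also have "(\<Sum>i<n. ?N i * (case i of 0 \<Rightarrow> 0 | Suc j \<Rightarrow> ?H j)) = (\<Sum>i<n'. ?N (Suc i) * ?H i)"
    unfolding n sum.lessThan_Suc_shift by simp
  \<comment> \<open>The added term \<open>i = n'\<close> contains \<open>?N n\<close>, which is
    zero; both sums now have the same range.\<close>
  also have "\<dots> = (\<Sum>i<n. ?N (Suc i) * ?H i)"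
    unfolding n using vanish[unfolded n] by (simp del: prod.lessThan_Suc)
  also have "(\<Sum>i<n. x i * ?N i * ?H i) - (\<Sum>i<n. ?N (Suc i) * ?H i) = x r * (\<Sum>i<n. ?N i * ?H i)"
    unfolding sum_subtractf[symmetric] sum_distrib_left
    by (rule sum.cong) (simp_all add: algebra_simps)
  finally show ?case
    using Suc by simp
qed

text \<open>Grouping by the larger index makes factor \<open>i\<close> the diagonal entry
  \<open>i\<close> of the triangular matrix in the factorization below.\<close>

lemma vandermonde_eq_prod_lessThan:
  "vandermonde n x = (\<Prod>i<n. \<Prod>m<i. x (Suc m) - x (Suc i))"
proof -
  have "vandermonde n x = (\<Prod>(i, j)\<in>(SIGMA i:{1..n}. {i<..n}). x i - x j)"
    unfolding vandermonde_def by (rule prod.Sigma) auto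
  also have "\<dots> = (\<Prod>(i, m)\<in>(SIGMA i:{..<n}. {..<i}). x (Suc m) - x (Suc i))"
    by (rule prod.reindex_bij_witness[of _ "\<lambda>(i, m). (Suc m, Suc i)" "\<lambda>(i, j). (j - 1, i - 1)"])
       auto
  also have "\<dots> = (\<Prod>i<n. \<Prod>m<i. x (Suc m) - x (Suc i))"
    by (rule prod.Sigma[symmetric]) auto
  finally show ?thesis .
qed

text \<open>Interpolation at the nodes factors the matrix as \<open>?L * ?H\<close>. Above the
  diagonal an entry of \<open>?L\<close> contains the factor with \<open>m = i\<close>, which is
  zero, so \<open>det ?L\<close> is the product of the diagonal. No division occurs.\<close>

lemma alternant_eq_vandermonde_mult:
  fixes x :: "nat \<Rightarrow> 'a :: comm_ring_1"
  shows "det (mat n n (\<lambda>(i, j). x (Suc i) ^ e j)) =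
    vandermonde n x * det (mat n n (\<lambda>(i, j). newton_coeff (\<lambda>m. x (Suc m)) (e j) i))"
proof -
  let ?L = "mat n n (\<lambda>(i, j). \<Prod>m<j. x (Suc m) - x (Suc i))"
  let ?H = "mat n n (\<lambda>(i, j). newton_coeff (\<lambda>m. x (Suc m)) (e j) i)"
  have "mat n n (\<lambda>(i, j). x (Suc i) ^ e j) = ?L * ?H"
  proof (rule eq_matI)
    fix i j assume "i < dim_row (?L * ?H)" "j < dim_col (?L * ?H)"
    then have "i < n" "j < n"
      by auto
    then show "mat n n (\<lambda>(i, j). x (Suc i) ^ e j) $$ (i, j) = (?L * ?H) $$ (i, j)"
      using newton_interpolation[of i n "\<lambda>m. x (Suc m)" "e j"]
      by (simp add: scalar_prod_def atLeast0LessThan)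
  qed auto
  then have "det (mat n n (\<lambda>(i, j). x (Suc i) ^ e j)) = det ?L * det ?H"
    by (simp add: det_mult[of _ n])
  moreover have "det ?L = prod_list (diag_mat ?L)"
    by (rule det_lower_triangular[of n]) (auto intro!: prod_zero)
  moreover have "\<dots> = vandermonde n x"
    by (simp add: prod_list_diag_prod vandermonde_eq_prod_lessThan atLeast0LessThan)
  ultimately show ?thesis
    by simp
qed


section \<open>Congruence of power series up to a given degree\<close>

text \<open>For fixed \<open>d\<close> these series form an ideal, by the closure lemmas that
  follow; congruence of \<open>f\<close> and \<open>g\<close> modulo it is
  \<open>vanishes_below d (f - g)\<close>.\<close>

definition vanishes_below :: "nat \<Rightarrow> ('v, 'a :: zero) mfps \<Rightarrow> bool" where
  "vanishes_below d f \<longleftrightarrow> (\<forall>m. size m < d \<longrightarrow> mfps_coeff f m = 0)"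

lemma vanishes_below_0 [simp]: "vanishes_below d (0 :: ('v, 'a :: comm_ring_1) mfps)"
  by (simp add: vanishes_below_def)

lemma vanishes_below_trivial [simp]: "vanishes_below 0 f"
  by (simp add: vanishes_below_def)

lemma vanishes_below_mono: "vanishes_below d f \<Longrightarrow> c \<le> d \<Longrightarrow> vanishes_below c f"
  by (auto simp: vanishes_below_def)

lemma vanishes_below_add:
  fixes f g :: "('v, 'a :: comm_ring_1) mfps"
  shows "vanishes_below d f \<Longrightarrow> vanishes_below d g \<Longrightarrow> vanishes_below d (f + g)"
  by (simp add: vanishes_below_def)

lemma vanishes_below_diff:
  fixes f g :: "('v, 'a :: comm_ring_1) mfps"
  shows "vanishes_below d f \<Longrightarrow> vanishes_below d g \<Longrightarrow> vanishes_below d (f - g)"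
  by (simp add: vanishes_below_def)

lemma vanishes_below_mult:
  fixes f g :: "('v, 'a :: comm_ring_1) mfps"
  assumes "vanishes_below c f" "vanishes_below d g"
  shows "vanishes_below (c + d) (f * g)"
  unfolding vanishes_below_def
proof (intro allI impI)
  fix m :: "'v multiset" assume m: "size m < c + d"
  have "mfps_coeff f a * mfps_coeff g b = 0" if "(a, b) \<in> splits m" for a b
  proof -
    have "size a + size b < c + d"
      using that m by (auto simp: splits_def)
    then have "size a < c \<or> size b < d"
      by linarith
    then show ?thesis
      using assms by (auto simp: vanishes_below_def)
  qed
  then show "mfps_coeff (f * g) m = 0"
    by (auto simp: mfps_coeff_mult intro!: sum.neutral)
qed

lemma vanishes_below_mult_left:
  fixes f g :: "('v, 'a :: comm_ring_1) mfps"
  shows "vanishes_below d g \<Longrightarrow> vanishes_below d (f * g)"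
  using vanishes_below_mult[of 0 f d g] by simp

lemma vanishes_below_mult_right:
  fixes f g :: "('v, 'a :: comm_ring_1) mfps"
  shows "vanishes_below d f \<Longrightarrow> vanishes_below d (f * g)"
  using vanishes_below_mult[of d f 0 g] by simp

lemma vanishes_below_sum:
  fixes f :: "'i \<Rightarrow> ('v, 'a :: comm_ring_1) mfps"
  shows "(\<And>i. i \<in> A \<Longrightarrow> vanishes_below d (f i)) \<Longrightarrow> vanishes_below d (sum f A)"
  by (induction A rule: infinite_finite_induct) (auto intro: vanishes_below_add)

lemma vanishes_below_power:
  fixes z :: "('v, 'a :: comm_ring_1) mfps"
  shows "vanishes_below 1 z \<Longrightarrow> vanishes_below k (z ^ k)"
  by (induction k) (use vanishes_below_mult[of 1 z] in auto)

lemma vanishes_below_prod_diff: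
  fixes f g :: "'i \<Rightarrow> ('v, 'a :: comm_ring_1) mfps"
  assumes "\<And>i. i \<in> A \<Longrightarrow> vanishes_below d (f i - g i)"
  shows "vanishes_below d (prod f A - prod g A)"
  using assms
proof (induction A rule: infinite_finite_induct)
  case (insert i A)
  \<comment> \<open>Exchange one factor at a time.\<close>
  have "prod f (insert i A) - prod g (insert i A) =
      (f i - g i) * prod f A + g i * (prod f A - prod g A)"
    using insert by (simp add: algebra_simps)
  then show ?case
    using insert by (simp add: vanishes_below_add vanishes_below_mult_left vanishes_below_mult_right)
qed auto

text \<open>The Leibniz expansions carry the same signs, which leaves differences of
  products.\<close>

lemma vanishes_below_det_diff:
  fixes f g :: "nat \<Rightarrow> nat \<Rightarrow> ('v, 'a :: comm_ring_1) mfps"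
  assumes "\<And>i j. i < n \<Longrightarrow> j < n \<Longrightarrow> vanishes_below d (f i j - g i j)"
  shows "vanishes_below d (det (mat n n (\<lambda>(i, j). f i j)) - det (mat n n (\<lambda>(i, j). g i j)))"
proof -
  have det: "det (mat n n (\<lambda>(i, j). h i j)) =
      (\<Sum>p | p permutes {0..<n}. signof p * (\<Prod>i=0..<n. h i (p i)))"
    for h :: "nat \<Rightarrow> nat \<Rightarrow> ('v, 'a) mfps"
    unfolding det_def by (auto intro!: sum.cong prod.cong arg_cong2[where f = "(*)"])
  have "vanishes_below d (signof p * ((\<Prod>i=0..<n. f i (p i)) - (\<Prod>i=0..<n. g i (p i))))"
    if p: "p permutes {0..<n}" for p
    using permutes_in_image[OF p] assms
    by (intro vanishes_below_mult_left vanishes_below_prod_diff) auto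
  then show ?thesis
    unfolding det sum_subtractf[symmetric] right_diff_distrib[symmetric]
    by (intro vanishes_below_sum) auto
qed

lemma mfps_eqI_vanishes_below:
  fixes f g :: "('v, 'a :: comm_ring_1) mfps"
  assumes "\<And>d. vanishes_below d (f - g)"
  shows "f = g"
proof (rule mfps_eqI)
  show "mfps_coeff f m = mfps_coeff g m" for m
    using assms[of "Suc (size m)"] by (simp add: vanishes_below_def)
qed

section \<open>Summable families\<close>

lemma mfps_coeff_sum: "mfps_coeff (sum f A) m = (\<Sum>i\<in>A. mfps_coeff (f i) m)"
  for f :: "'i \<Rightarrow> ('v, 'a :: comm_ring_1) mfps"
  by (induction A rule: infinite_finite_induct) auto

text \<open>Only members of weight at most \<open>size m\<close> can contribute to the coefficient
  at \<open>m\<close>, and these are finitely many; members of weight at least \<open>d\<close> are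
  invisible below degree \<open>d\<close>.\<close>

lemma mfps_summable:
  fixes g :: "'i \<Rightarrow> ('v, 'a :: comm_ring_1) mfps"
  assumes g: "\<And>i. i \<in> A \<Longrightarrow> vanishes_below (w i) (g i)"
    and fin: "\<And>d. finite {i \<in> A. w i < d}"
  obtains S where "mfps_has_sum g A S" "\<And>d. vanishes_below d (S - (\<Sum>i | i \<in> A \<and> w i < d. g i))"
proof -
  define S where "S = Abs_mfps (\<lambda>m. \<Sum>i | i \<in> A \<and> mfps_coeff (g i) m \<noteq> 0. mfps_coeff (g i) m)"
  have sub: "{i \<in> A. mfps_coeff (g i) m \<noteq> 0} \<subseteq> {i \<in> A. w i < d}" if "size m < d" for m d
    using g that by (auto simp: vanishes_below_def) (meson le_less_trans not_less)
  have "mfps_has_sum g A S"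
    unfolding mfps_has_sum_def S_def using finite_subset[OF sub[OF lessI] fin] by simp
  moreover have "vanishes_below d (S - (\<Sum>i | i \<in> A \<and> w i < d. g i))" for d
    unfolding vanishes_below_def
  proof (intro allI impI)
    fix m :: "'v multiset" assume "size m < d"
    then have "mfps_coeff S m = (\<Sum>i | i \<in> A \<and> w i < d. mfps_coeff (g i) m)"
      unfolding S_def mfps_coeff_Abs using sub[of m d] fin by (intro sum.mono_neutral_left) auto
    then show "mfps_coeff (S - (\<Sum>i | i \<in> A \<and> w i < d. g i)) m = 0"
      by (simp add: mfps_coeff_sum)
  qed
  ultimately show ?thesis
    by (rule that)
qed


section \<open>Schur polynomials as power series\<close>

text \<open>One step of the recursion raises \<open>k - i\<close> by at most one, matched by the
  factor \<open>x i\<close>. For \<open>k < i\<close> the truncated bound is the trivial 0.\<close>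

lemma vanishes_below_newton_coeff:
  fixes x :: "nat \<Rightarrow> ('v, 'a :: comm_ring_1) mfps"
  assumes "\<And>i. vanishes_below 1 (x i)"
  shows "vanishes_below (k - i) (newton_coeff x k i)"
proof (induction k arbitrary: i)
  case (Suc k)
  have "vanishes_below (Suc k - i) (x i * newton_coeff x k i)"
    using vanishes_below_mult[OF assms[of i] Suc[of i]] by (rule vanishes_below_mono) simp
  moreover have "vanishes_below (Suc k - i) (case i of 0 \<Rightarrow> 0 | Suc j \<Rightarrow> newton_coeff x k j)"
    using Suc by (auto split: nat.split)
  ultimately show ?case
    by (simp add: vanishes_below_diff)
qed simp

text \<open>A division-free form of the Schur polynomial, of Jacobi-Trudi type: the cofactor of the
  Vandermonde product in the alternant. It makes sense among power series, where the quotient cannot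
  be formed directly.\<close>

definition schur_poly :: "nat \<Rightarrow> nat list \<Rightarrow> (nat \<Rightarrow> 'a) \<Rightarrow> 'a :: comm_ring_1" where
  "schur_poly n l x =
     det (mat n n (\<lambda>(i, j). newton_coeff (\<lambda>m. x (Suc m)) (shifted_part n l j) i))"

lemma alternant_eq_vandermonde_mult_schur_poly:
  "det (mat n n (\<lambda>(i, j). x (Suc i) ^ shifted_part n l j)) = vandermonde n x * schur_poly n l x"
  unfolding schur_poly_def by (rule alternant_eq_vandermonde_mult)

text \<open>Every Leibniz term has a factor from column 0, where the exponent is
  \<open>part l 1 + n - 1\<close>. In row \<open>i\<close> its order is at least that minus
  \<open>i\<close>, and \<open>i \<le> n - 1\<close>.\<close>

lemma vanishes_below_schur_poly:
  fixes x :: "nat \<Rightarrow> ('v, 'a :: comm_ring_1) mfps"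
  assumes "1 \<le> n" and x: "\<And>i. vanishes_below 1 (x i)"
  shows "vanishes_below (part l 1) (schur_poly n l x)"
proof -
  let ?h = "\<lambda>i j. newton_coeff (\<lambda>m. x (Suc m)) (shifted_part n l j) i"
  have "vanishes_below (part l 1) (signof p * (\<Prod>i=0..<n. ?h i (p i)))"
    if p: "p permutes {0..<n}" for p
  proof -
    have "0 \<in> p ` {0..<n}"
      using assms(1) permutes_image[OF p] by simp
    then obtain i where i: "i < n" "p i = 0"
      by auto
    have "vanishes_below (part l 1) (?h i 0)"
      using vanishes_below_newton_coeff[of "\<lambda>m. x (Suc m)", OF x]
      by (rule vanishes_below_mono) (use i in \<open>auto simp: shifted_part_def\<close>)
    moreover have "(\<Prod>i=0..<n. ?h i (p i)) = ?h i 0 * (\<Prod>i\<in>{0..<n} - {i}. ?h i (p i))"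
      using i prod.remove[of "{0..<n}" i "\<lambda>i. ?h i (p i)"] by simp
    ultimately show ?thesis
      by (simp add: vanishes_below_mult_left vanishes_below_mult_right)
  qed
  moreover have "schur_poly n l x =
      (\<Sum>p | p permutes {0..<n}. signof p * (\<Prod>i=0..<n. ?h i (p i)))"
    unfolding schur_poly_def det_def
    by (auto intro!: sum.cong prod.cong arg_cong2[where f = "(*)"])
  ultimately show ?thesis
    by (auto intro!: vanishes_below_sum)
qed

section \<open>Passage to the field of fractions\<close>

lemma comm_ring_hom_to_fract: "comm_ring_hom (to_fract :: 'a :: idom \<Rightarrow> 'a fract)"
  by unfold_locales auto

lemma det_map_to_fract:
  "det (mat n n (\<lambda>(i, j). to_fract (a i j))) = to_fract (det (mat n n (\<lambda>(i, j). a i j)))"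
proof -
  have "mat n n (\<lambda>(i, j). to_fract (a i j)) = map_mat to_fract (mat n n (\<lambda>(i, j). a i j))"
    by (rule eq_matI) auto
  then show ?thesis
    using comm_ring_hom.hom_det[OF comm_ring_hom_to_fract] by metis
qed

lemma to_fract_prod: "to_fract (prod f A) = (\<Prod>i\<in>A. to_fract (f i))"
  by (induction A rule: infinite_finite_induct) auto

lemma vandermonde_to_fract: "vandermonde n (\<lambda>i. to_fract (x i)) = to_fract (vandermonde n x)"
  by (simp add: vandermonde_def to_fract_prod)

text \<open>Cancelling the Vandermonde product shows that the quotient lies in the subring, as
  \<open>fract_has_sum\<close> requires.\<close>

lemma schur_to_fract:
  fixes x :: "nat \<Rightarrow> 'a :: idom"
  assumes "vandermonde n x \<noteq> 0"
  shows "schur n l (\<lambda>i. to_fract (x i)) = to_fract (schur_poly n l x)"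
proof -
  have "mat1 n (\<lambda>i j. to_fract (x i) ^ (part l j + n - j)) =
      mat n n (\<lambda>(i, j). to_fract (x (Suc i) ^ shifted_part n l j))"
    by (simp add: mat1_def shifted_part_def to_fract_power)
  then have "det (mat1 n (\<lambda>i j. to_fract (x i) ^ (part l j + n - j))) =
      to_fract (vandermonde n x) * to_fract (schur_poly n l x)"
    by (simp only: det_map_to_fract alternant_eq_vandermonde_mult_schur_poly to_fract_mult)
  then show ?thesis
    using assms by (simp add: schur_def vandermonde_to_fract)
qed


section \<open>The Cauchy identity\<close>

lemma det_scale_columns:
  fixes a :: "nat \<Rightarrow> nat \<Rightarrow> 'a :: comm_ring_1"
  shows "det (mat n n (\<lambda>(i, j). c j * a i j)) = (\<Prod>j<n. c j) * det (mat n n (\<lambda>(i, j). a i j))"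
proof -
  have det: "det (mat n n (\<lambda>(i, j). h i j)) =
      (\<Sum>p | p permutes {0..<n}. signof p * (\<Prod>i=0..<n. h i (p i)))"
    for h :: "nat \<Rightarrow> nat \<Rightarrow> 'a"
    unfolding det_def by (auto intro!: sum.cong prod.cong arg_cong2[where f = "(*)"])
  have "(\<Prod>i=0..<n. c (p i)) = (\<Prod>j<n. c j)" if "p permutes {0..<n}" for p
    using prod.permute[OF that, of c] by (simp add: o_def atLeast0LessThan)
  then show ?thesis
    unfolding det sum_distrib_left by (intro sum.cong) (auto simp: prod.distrib mult_ac)
qed

text \<open>Cauchy-Binet for the factors \<open>(1 - t ^ Suc k) * x (Suc i) ^ k\<close> and
  \<open>y (Suc j) ^ k\<close>: the scalars leave the columns, and both alternants split off a
  Vandermonde product.\<close>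

lemma truncated_cauchy_identity:
  fixes x y :: "nat \<Rightarrow> 'a :: comm_ring_1"
  shows "det (mat n n (\<lambda>(i, j). \<Sum>k<N. (1 - t ^ Suc k) * (x (Suc i) * y (Suc j)) ^ k)) =
    vandermonde n x * vandermonde n y *
    (\<Sum>l | is_partition l \<and> length l \<le> n \<and> (\<forall>i<n. shifted_part n l i < N).
       (\<Prod>i<n. 1 - t ^ Suc (shifted_part n l i)) * schur_poly n l x * schur_poly n l y)"
proof -
  have "det (mat n n (\<lambda>(i, j). y (Suc j) ^ shifted_part n l i)) =
      vandermonde n y * schur_poly n l y" for l
  proof -
    have "mat n n (\<lambda>(i, j). y (Suc j) ^ shifted_part n l i) =
        transpose_mat (mat n n (\<lambda>(i, j). y (Suc i) ^ shifted_part n l j))"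
      by (rule eq_matI) auto
    then show ?thesis
      by (simp add: det_transpose[of _ n] alternant_eq_vandermonde_mult_schur_poly)
  qed
  moreover have "det (mat n n (\<lambda>(i, j). (1 - t ^ Suc (shifted_part n l j)) * x (Suc i) ^ shifted_part n l j)) =
      (\<Prod>i<n. 1 - t ^ Suc (shifted_part n l i)) * (vandermonde n x * schur_poly n l x)" for l
    unfolding det_scale_columns alternant_eq_vandermonde_mult_schur_poly ..
  ultimately show ?thesis
    using cauchy_binet_partitions[where n = n and N = N and
        a = "\<lambda>i k. (1 - t ^ Suc k) * x (Suc i) ^ k" and b = "\<lambda>k j. y (Suc j) ^ k"]
    by (simp add: power_mult_distrib sum_distrib_left mult_ac del: power_Suc)
qed

section \<open>The kernel as a power series\<close>

lemma vanishes_below_geometric_diff: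
  fixes z :: "('v, 'a :: comm_ring_1) mfps"
  assumes "vanishes_below 1 z" "(1 - z) * S = 1"
  shows "vanishes_below N (S - (\<Sum>k<N. z ^ k))"
proof -
  have "S - (\<Sum>k<N. z ^ k) = S - (S * (1 - z)) * (\<Sum>k<N. z ^ k)"
    using assms(2) by (simp add: mult.commute)
  also have "\<dots> = S * (1 - (1 - z) * (\<Sum>k<N. z ^ k))"
    by (simp add: algebra_simps)
  also have "\<dots> = S * z ^ N"
    by (simp add: one_diff_power_eq[symmetric])
  finally show ?thesis
    using vanishes_below_power[OF assms(1)] by (simp add: vanishes_below_mult_left)
qed

text \<open>Partial fractions: with \<open>S\<close> and \<open>S'\<close> inverse to
  \<open>1 - z\<close> and \<open>1 - t * z\<close>, the kernel is \<open>S - t * S'\<close>, whose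
  term in \<open>z ^ k\<close> is \<open>(1 - t * t ^ k) * z ^ k\<close>.\<close>

lemma ex_cauchy_kernel:
  fixes z t :: "('v :: wellorder, 'a :: idom) mfps"
  assumes z: "vanishes_below 1 z"
  shows "\<exists>K. to_fract K = (1 - to_fract t) / ((1 - to_fract z) * (1 - to_fract t * to_fract z)) \<and>
    (\<forall>N. vanishes_below N (K - (\<Sum>k<N. (1 - t ^ Suc k) * z ^ k)))"
proof -
  have tz: "vanishes_below 1 (t * z)"
    using z by (rule vanishes_below_mult_left)
  obtain S where S: "(1 - z) * S = 1"
    using mfps_geometric[of z] z by (auto simp: vanishes_below_def)
  obtain S' where S': "(1 - t * z) * S' = 1"
    using mfps_geometric[of "t * z"] tz by (auto simp: vanishes_below_def)
  have nz: "1 - z \<noteq> 0" "1 - t * z \<noteq> 0"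
    using S S' by auto
  have "(S - t * S') * ((1 - z) * (1 - t * z)) =
      ((1 - z) * S) * (1 - t * z) - t * ((1 - t * z) * S') * (1 - z)"
    by (simp add: algebra_simps)
  also have "\<dots> = 1 - t"
    unfolding S S' by (simp add: algebra_simps)
  finally have "to_fract (S - t * S') * (to_fract (1 - z) * to_fract (1 - t * z)) = to_fract (1 - t)"
    by (simp only: to_fract_mult[symmetric])
  then have "to_fract (S - t * S') = to_fract (1 - t) / (to_fract (1 - z) * to_fract (1 - t * z))"
    using nz by (simp add: eq_divide_eq del: to_fract_diff to_fract_mult)
  moreover have "vanishes_below N (S - t * S' - (\<Sum>k<N. (1 - t ^ Suc k) * z ^ k))" for N
  proof -
    have "S - t * S' - (\<Sum>k<N. (1 - t ^ Suc k) * z ^ k) =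
        (S - (\<Sum>k<N. z ^ k)) - t * (S' - (\<Sum>k<N. (t * z) ^ k))"
      by (simp add: algebra_simps sum_subtractf sum_distrib_left power_mult_distrib)
    then show ?thesis
      using vanishes_below_geometric_diff[OF z S, of N] vanishes_below_geometric_diff[OF tz S', of N]
      by (simp only: vanishes_below_diff vanishes_below_mult_left)
  qed
  ultimately show ?thesis
    by (intro exI[of _ "S - t * S'"]) simp
qed

section \<open>From truncations to the full sum\<close>

lemma finite_bounded_partitions:
  "finite {l \<in> {l. is_partition l \<and> length l \<le> n}. part l 1 < d}"
proof (rule finite_subset)
  show "{l \<in> {l. is_partition l \<and> length l \<le> n}. part l 1 < d} \<subseteq>
      {l. set l \<subseteq> {..<d} \<and> length l \<le> n}"
  proof clarsimp
    fix l p assume l: "is_partition l" "part l (Suc 0) < d" and "p \<in> set l"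
    then obtain k where "k < length l" "p = part l (Suc k)"
      by (auto simp: in_set_conv_nth part_def)
    then show "p < d"
      using part_antimono[OF l(1), of 1 "Suc k"] l(2) by simp
  qed
  show "finite {l. set l \<subseteq> {..<d} \<and> length l \<le> n}"
    by (rule finite_lists_length_le) simp
qed

text \<open>The largest shifted part sits at \<open>i = 0\<close> and equals
  \<open>part l 1 + n - 1\<close>. This translates the Cauchy-Binet cutoff into the weight used for
  summation.\<close>

lemma all_shifted_part_less_iff:
  assumes "is_partition l" "1 \<le> n"
  shows "(\<forall>i<n. shifted_part n l i < d + n - 1) \<longleftrightarrow> part l 1 < d"
proof
  assume "\<forall>i<n. shifted_part n l i < d + n - 1"
  then have "shifted_part n l 0 < d + n - 1"
    using assms(2) by simp
  then show "part l 1 < d"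
    using assms(2) by (simp add: shifted_part_def)
next
  assume "part l 1 < d"
  then show "\<forall>i<n. shifted_part n l i < d + n - 1"
  proof (intro allI impI)
    fix i assume "part l 1 < d" "i < n"
    then show "shifted_part n l i < d + n - 1"
      using part_antimono[OF assms(1), of 1 "Suc i"] by (simp add: shifted_part_def)
  qed
qed

text \<open>Below any degree \<open>d\<close>, both sides agree with the truncated identity: on the
  left the partitions with \<open>part l 1 \<ge> d\<close> are invisible, on the right the tails of
  the kernels.\<close>

lemma cauchy_identity_mfps:
  fixes x y :: "nat \<Rightarrow> ('v, 'a :: comm_ring_1) mfps"
  assumes "1 \<le> n"
    and x: "\<And>i. vanishes_below 1 (x i)" and y: "\<And>i. vanishes_below 1 (y i)"
    and K: "\<And>i j N. vanishes_below N (K i j - (\<Sum>k<N. (1 - t ^ Suc k) * (x (Suc i) * y (Suc j)) ^ k))"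
  shows "\<exists>S. mfps_has_sum
      (\<lambda>l. (\<Prod>i<n. 1 - t ^ Suc (shifted_part n l i)) * schur_poly n l x * schur_poly n l y)
      {l. is_partition l \<and> length l \<le> n} S \<and>
    vandermonde n x * vandermonde n y * S = det (mat n n (\<lambda>(i, j). K i j))"
proof -
  let ?g = "\<lambda>l. (\<Prod>i<n. 1 - t ^ Suc (shifted_part n l i)) * schur_poly n l x * schur_poly n l y"
  let ?A = "{l. is_partition l \<and> length l \<le> n}"
  let ?V = "vandermonde n x * vandermonde n y"
  have "vanishes_below (part l 1) (?g l)" for l
    using vanishes_below_schur_poly[OF assms(1) y] by (rule vanishes_below_mult_left)
  then obtain S where S: "mfps_has_sum ?g ?A S"
      "\<And>d. vanishes_below d (S - (\<Sum>l | l \<in> ?A \<and> part l 1 < d. ?g l))"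
    using mfps_summable[of ?A "\<lambda>l. part l 1" ?g, OF _ finite_bounded_partitions] by blast
  have "?V * S = det (mat n n (\<lambda>(i, j). K i j))"
  proof (rule mfps_eqI_vanishes_below)
    fix d
    \<comment> \<open>This cutoff selects exactly the partitions with \<open>part l 1 < d\<close>,
      and it is at least \<open>d\<close> since \<open>1 \<le> n\<close>, so truncating the kernels
      changes nothing below degree \<open>d\<close>.\<close>
    let ?N = "d + n - 1"
    let ?P = "\<Sum>l | l \<in> ?A \<and> part l 1 < d. ?g l"
    let ?D = "det (mat n n (\<lambda>(i, j). \<Sum>k<?N. (1 - t ^ Suc k) * (x (Suc i) * y (Suc j)) ^ k))"
    have "{l. l \<in> ?A \<and> part l 1 < d} =
        {l. is_partition l \<and> length l \<le> n \<and> (\<forall>i<n. shifted_part n l i < ?N)}"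
      using all_shifted_part_less_iff[OF _ assms(1)] by auto
    then have D: "?D = ?V * ?P"
      by (simp only: truncated_cauchy_identity)
    have "vanishes_below d (?V * (S - ?P))"
      using S(2) by (rule vanishes_below_mult_left)
    moreover have "vanishes_below d (det (mat n n (\<lambda>(i, j). K i j)) - ?D)"
      by (intro vanishes_below_det_diff vanishes_below_mono[OF K[of ?N]]) (use assms(1) in simp)
    ultimately have "vanishes_below d (?V * (S - ?P) - (det (mat n n (\<lambda>(i, j). K i j)) - ?D))"
      by (rule vanishes_below_diff)
    then show "vanishes_below d (?V * S - det (mat n n (\<lambda>(i, j). K i j)))"
      unfolding D by (simp only: right_diff_distrib diff_diff_eq2 diff_add_cancel)
  qed
  with S(1) show ?thesis
    by blast
qed

section \<open>Specialization to the indeterminates\<close>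

lemma vanishes_below_mfps_var: "vanishes_below 1 (mfps_var v :: ('v, 'a :: comm_ring_1) mfps)"
  by (simp add: vanishes_below_def mfps_var_def)

lemma mfps_var_eq_iff: "(mfps_var v :: ('v, 'a :: comm_ring_1) mfps) = mfps_var w \<longleftrightarrow> v = w"
proof
  assume "(mfps_var v :: ('v, 'a) mfps) = mfps_var w"
  then have "mfps_coeff (mfps_var v :: ('v, 'a) mfps) {#v#} = mfps_coeff (mfps_var w) {#v#}"
    by simp
  then show "v = w"
    by (simp add: mfps_var_def split: if_splits)
qed simp

lemma vandermonde_neq_0:
  fixes x :: "nat \<Rightarrow> 'a :: idom"
  shows "inj x \<Longrightarrow> vandermonde n x \<noteq> 0"
  by (auto simp: vandermonde_def inj_eq)

theorem theorem1:
  fixes n :: nat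
    and x y :: "nat \<Rightarrow> 'a :: idom series_fract"
    and t :: "'a series_fract"
  assumes "n \<ge> 1"
  defines "x \<equiv> indet_x" and "y \<equiv> indet_y" and "t \<equiv> indet_t"
  shows "fract_has_sum
    (\<lambda>l. (\<Prod>i=1..n. (1 - t ^ (part l i + n + 1 - i))) * schur n l x * schur n l y)
    {l. is_partition l \<and> length l \<le> n}
    (1 / ((\<Prod>i\<in>{1..n}. \<Prod>j\<in>{i<..n}. (x i - x j)) * (\<Prod>i\<in>{1..n}. \<Prod>j\<in>{i<..n}. (y i - y j)))
      * det (mat1 n (\<lambda>i j. (1 - t) / ((1 - x i * y j) * (1 - t * x i * y j)))))"
proof -
  \<comment> \<open>Preimages of the indeterminates among power series, where the identity is
    available.\<close>
  define X Y :: "nat \<Rightarrow> (nat, 'a poly) mfps"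
    where "X = (\<lambda>i. mfps_var (2 * i))" and "Y = (\<lambda>i. mfps_var (2 * i + 1))"
  define T :: "(nat, 'a poly) mfps" where "T = mfps_const [:0, 1:]"
  have x: "x = (\<lambda>i. to_fract (X i))" and y: "y = (\<lambda>i. to_fract (Y i))" and t: "t = to_fract T"
    by (simp_all add: fun_eq_iff x_def y_def t_def indet_x_def indet_y_def indet_t_def
        X_def Y_def T_def)
  have X: "vanishes_below 1 (X i)" and Y: "vanishes_below 1 (Y i)" for i
    unfolding X_def Y_def by (rule vanishes_below_mfps_var)+
  have VX: "vandermonde n X \<noteq> 0" and VY: "vandermonde n Y \<noteq> 0"
    unfolding X_def Y_def
    by (rule vandermonde_neq_0; simp add: inj_def mfps_var_eq_iff)+
  \<comment> \<open>Both properties go into one predicate so that a single choice of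
    \<open>K\<close> has them together.\<close>
  define Q where "Q i j k \<longleftrightarrow>
      to_fract k = (1 - t) / ((1 - x (Suc i) * y (Suc j)) * (1 - t * x (Suc i) * y (Suc j))) \<and>
      (\<forall>N. vanishes_below N (k - (\<Sum>k<N. (1 - T ^ Suc k) * (X (Suc i) * Y (Suc j)) ^ k)))"
    for i j k
  have "\<exists>k. Q i j k" for i j
    using ex_cauchy_kernel[of "X (Suc i) * Y (Suc j)" T, OF vanishes_below_mult_left[OF Y]]
    unfolding Q_def x y t by (simp only: to_fract_mult mult.assoc)
  then obtain K where "\<And>i j. Q i j (K i j)"
    by metis
  then have
    K_fract: "\<And>i j. to_fract (K i j) =
      (1 - t) / ((1 - x (Suc i) * y (Suc j)) * (1 - t * x (Suc i) * y (Suc j)))" and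
    K: "\<And>i j N. vanishes_below N (K i j - (\<Sum>k<N. (1 - T ^ Suc k) * (X (Suc i) * Y (Suc j)) ^ k))"
    unfolding Q_def by simp_all
  let ?g = "\<lambda>l. (\<Prod>i<n. 1 - T ^ Suc (shifted_part n l i)) * schur_poly n l X * schur_poly n l Y"
  obtain S where S: "mfps_has_sum ?g {l. is_partition l \<and> length l \<le> n} S"
    and VS: "vandermonde n X * vandermonde n Y * S = det (mat n n (\<lambda>(i, j). K i j))"
    using cauchy_identity_mfps[where x = X and y = Y and t = T and K = K, OF assms(1) X Y K] by blast
  have "(\<Prod>i=1..n. 1 - t ^ (part l i + n + 1 - i)) =
      to_fract (\<Prod>i<n. 1 - T ^ Suc (shifted_part n l i))" for l
  proof -
    \<comment> \<open>After the index shift the exponent is \<open>part l (Suc i) + n - i\<close>,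
      the successor of the shifted part because \<open>i < n\<close>.\<close>
    have "(\<Prod>i=1..n. 1 - t ^ (part l i + n + 1 - i)) = (\<Prod>i<n. 1 - t ^ Suc (shifted_part n l i))"
      by (rule prod.reindex_bij_witness[of _ Suc "\<lambda>i. i - 1"])
         (auto simp: shifted_part_def Suc_diff_le simp del: power_Suc)
    then show ?thesis
      by (simp add: t to_fract_prod to_fract_power del: power_Suc)
  qed
  then have "(\<Prod>i=1..n. 1 - t ^ (part l i + n + 1 - i)) * schur n l x * schur n l y = to_fract (?g l)"
    for l
    unfolding x y by (simp add: schur_to_fract VX VY)
  moreover have "1 / ((\<Prod>i\<in>{1..n}. \<Prod>j\<in>{i<..n}. (x i - x j)) * (\<Prod>i\<in>{1..n}. \<Prod>j\<in>{i<..n}. (y i - y j)))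
      * det (mat1 n (\<lambda>i j. (1 - t) / ((1 - x i * y j) * (1 - t * x i * y j)))) = to_fract S"
  proof -
    have "mat1 n (\<lambda>i j. (1 - t) / ((1 - x i * y j) * (1 - t * x i * y j))) =
        mat n n (\<lambda>(i, j). to_fract (K i j))"
      by (simp add: mat1_def K_fract)
    then have "det (mat1 n (\<lambda>i j. (1 - t) / ((1 - x i * y j) * (1 - t * x i * y j)))) =
        vandermonde n x * vandermonde n y * to_fract S"
      by (simp only: det_map_to_fract VS[symmetric] to_fract_mult x y vandermonde_to_fract)
    moreover have "vandermonde n x \<noteq> 0" "vandermonde n y \<noteq> 0"
      using VX VY by (simp_all add: x y vandermonde_to_fract)
    ultimately show ?thesis
      unfolding vandermonde_def[symmetric] by simp
  qed
  ultimately show ?thesis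
    unfolding fract_has_sum_def using S by (intro exI[of _ ?g] exI[of _ S]) auto
qed

end
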